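(* Let $n\geq1$ be an integer and $\mu$ a finite non-negative Borel measure on $\mathbb T$. Then for every $f\in\mathcal O(\mathbb D)$ and every $0\le r<1$, $$D_{\mu,n}(f_r)\le\frac{4^{n-1}(2-r)r^{2n}}{(1+r)^{2n-2}}D_{\mu,n}(f),$$ where $f_r(z)=f(rz)$.
   Context: $\mathbb D$ open unit disc, $\mathbb T$ unit circle, $dA$ normalized area measure on $\mathbb D$, $\mathcal O(\mathbb D)$ holomorphic functions on $\mathbb D$. $P_\mu(z)=\int_{\mathbb T}\frac{1-|z|^2}{|z-\zeta|^2}d\mu(\zeta)$ and $D_{\mu,n}(f)=\frac{1}{n!(n-1)!}\int_{\mathbb D}|f^{(n)}(z)|^2P_\mu(z)(1-|z|^2)^{n-1}dA(z)\in[0,\infty]$. *)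

theory Defs
  imports "HOL-Analysis.Analysis"
begin

definition dA :: "complex measure" where
  "dA = density (restrict_space lborel (ball 0 1)) (\<lambda>_. ennreal (1 / pi))"

text \<open>Poisson integral of a (non-negative) measure mu on the unit circle.
  For z in D the integrand is non-negative, so a non-negative integral is used.\<close>
definition poisson_int :: "complex measure \<Rightarrow> complex \<Rightarrow> ennreal" where
  "poisson_int \<mu> z =
     (\<integral>\<^sup>+ \<zeta>. ennreal ((1 - (cmod z)\<^sup>2) / (cmod (z - \<zeta>))\<^sup>2) \<partial>\<mu>)"

definition D_mu_n :: "complex measure \<Rightarrow> nat \<Rightarrow> (complex \<Rightarrow> complex) \<Rightarrow> ennreal" where
  "D_mu_n \<mu> n f =
     ennreal (1 / (fact n * fact (n - 1))) *
     (\<integral>\<^sup>+ z. ennreal ((cmod ((deriv ^^ n) f z))\<^sup>2) * poisson_int \<mu> z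
               * ennreal ((1 - (cmod z)\<^sup>2) ^ (n - 1)) \<partial>dA)"

end

theory Submission
  imports Defs "HOL-Complex_Analysis.Complex_Analysis"
begin

text \<open>
  For \<open>\<zeta>\<close> on the circle, the Poisson kernel times \<open>(1 - |z|\<^sup>2) ^ (n - 1)\<close> is
  \<open>(1 - |z|\<^sup>2) ^ n / |z - \<zeta>|\<^sup>2\<close>. So, by Tonelli, the claim reduces to comparing the weighted Bergman
  norms of \<open>h z = g z / (1 - \<omega> z)\<close> and \<open>g (r z) / (1 - \<omega> z)\<close>, where \<open>g\<close> is the \<open>n\<close>-th derivative of
  \<open>f\<close> and \<open>\<omega>\<close> is the conjugate of \<open>\<zeta>\<close>. Since
  \<open>(1 - r \<omega> z) / (1 - \<omega> z) = r + (1 - r) / (1 - \<omega> z)\<close>, each Taylor coefficient of the second function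
  is, up to unimodular factors, a convex combination of coefficients of \<open>h\<close>. Jensen's inequality,
  Parseval's identity and the recurrence of the radial moments then give the constant \<open>2 - r\<close> (times
  \<open>r ^ (2 n)\<close> from the chain rule), and \<open>(1 + r)\<^sup>2 \<le> 4\<close> accounts for the remaining factor.
\<close>

subsection \<open>Rotation invariance of planar Lebesgue measure\<close>

text \<open>Lebesgue measure is determined by its values on boxes, and a box in the complex plane
  pulls back to a product of two intervals. This turns planar integrals into iterated real
  ones.\<close>

lemma lborel_complex_eq_distr:
  "(lborel :: complex measure) = distr (lborel \<Otimes>\<^sub>M lborel) borel (\<lambda>p. Complex (fst p) (snd p))"
proof (rule lborel_eqI)
  fix l u :: complex
  assume le: "\<And>b. b \<in> Basis \<Longrightarrow> l \<bullet> b \<le> u \<bullet> b"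
  have pre: "(\<lambda>p. Complex (fst p) (snd p)) -` box l u = box (Re l) (Re u) \<times> box (Im l) (Im u)"
    by (auto simp: in_box_complex_iff box_real)
  have le': "Re l \<le> Re u" "Im l \<le> Im u"
    using le[of 1] le[of \<i>] by (auto simp: Basis_complex_def)
  have "emeasure (distr (lborel \<Otimes>\<^sub>M lborel) borel (\<lambda>p. Complex (fst p) (snd p))) (box l u)
      = emeasure (lborel \<Otimes>\<^sub>M lborel) (box (Re l) (Re u) \<times> box (Im l) (Im u))"
    by (subst emeasure_distr)
       (auto simp: pre space_pair_measure lborel_prod intro!: borel_measurable_continuous_onI continuous_intros)
  also have "\<dots> = ennreal (\<Prod>b\<in>Basis. (u - l) \<bullet> b)"
    using le' by (subst lborel.emeasure_pair_measure_Times)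
       (auto simp: Basis_complex_def box_real ennreal_mult)
  finally show "emeasure (distr (lborel \<Otimes>\<^sub>M lborel) borel (\<lambda>p. Complex (fst p) (snd p))) (box l u)
      = ennreal (\<Prod>b\<in>Basis. (u - l) \<bullet> b)" .
qed simp

lemma measurable_Complex [measurable]:
  "(\<lambda>p. Complex (fst p) (snd p)) \<in> borel_measurable (borel \<Otimes>\<^sub>M borel)"
  unfolding borel_prod by (intro borel_measurable_continuous_onI continuous_intros)

lemma nn_integral_lborel_complex:
  assumes [measurable]: "F \<in> borel_measurable borel"
  shows "(\<integral>\<^sup>+z. F z \<partial>lborel) = (\<integral>\<^sup>+x. \<integral>\<^sup>+y. F (Complex x y) \<partial>lborel \<partial>lborel)"
proof -
  have m[measurable]: "(\<lambda>p. Complex (fst p) (snd p)) \<in> borel_measurable (lborel \<Otimes>\<^sub>M lborel)"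
    using measurable_Complex by simp
  have "(\<integral>\<^sup>+z. F z \<partial>lborel) = (\<integral>\<^sup>+p. F (Complex (fst p) (snd p)) \<partial>(lborel \<Otimes>\<^sub>M lborel))"
    by (subst lborel_complex_eq_distr, subst nn_integral_distr) auto
  also have "\<dots> = (\<integral>\<^sup>+x. \<integral>\<^sup>+y. F (Complex x y) \<partial>lborel \<partial>lborel)"
    by (subst lborel.nn_integral_fst[symmetric]) auto
  finally show ?thesis .
qed

lemma nn_integral_lborel_complex_swap:
  assumes [measurable]: "F \<in> borel_measurable borel"
  shows "(\<integral>\<^sup>+z. F z \<partial>lborel) = (\<integral>\<^sup>+y. \<integral>\<^sup>+x. F (Complex x y) \<partial>lborel \<partial>lborel)"
proof -
  have m[measurable]: "(\<lambda>p. Complex (fst p) (snd p)) \<in> borel_measurable (lborel \<Otimes>\<^sub>M lborel)"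
    using measurable_Complex by simp
  show ?thesis
    unfolding nn_integral_lborel_complex[OF assms]
    by (rule lborel_pair.Fubini'[symmetric]) (simp add: case_prod_unfold)
qed

lemma nn_integral_lborel_translate:
  fixes F :: "real \<Rightarrow> ennreal"
  assumes "F \<in> borel_measurable borel"
  shows "(\<integral>\<^sup>+x. F (x + a) \<partial>lborel) = (\<integral>\<^sup>+x. F x \<partial>lborel)"
  using nn_integral_real_affine[OF assms, of 1 a] by (simp add: add.commute)

text \<open>For a fixed imaginary part the shear is a translation of the real coordinate, so the
  inner integral over that coordinate, taken first, does not change.\<close>

lemma nn_integral_lborel_shear_Re:
  assumes [measurable]: "F \<in> borel_measurable borel"
  shows "(\<integral>\<^sup>+z. F (Complex (Re z + a * Im z) (Im z)) \<partial>lborel) = (\<integral>\<^sup>+z. F z \<partial>lborel)"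
proof -
  have [measurable]: "(\<lambda>z. Complex (Re z + a * Im z) (Im z)) \<in> borel_measurable borel"
    by (intro borel_measurable_continuous_onI continuous_intros)
  have [measurable]: "(\<lambda>x. Complex x y) \<in> borel_measurable borel" for y
    by (intro borel_measurable_continuous_onI continuous_intros)
  have "(\<integral>\<^sup>+z. F (Complex (Re z + a * Im z) (Im z)) \<partial>lborel)
      = (\<integral>\<^sup>+y. \<integral>\<^sup>+x. F (Complex (x + a * y) y) \<partial>lborel \<partial>lborel)"
    by (subst nn_integral_lborel_complex_swap) auto
  also have "\<dots> = (\<integral>\<^sup>+y. \<integral>\<^sup>+x. F (Complex x y) \<partial>lborel \<partial>lborel)"
    using nn_integral_lborel_translate[of "\<lambda>x. F (Complex x y)" "a * y" for y] by simp
  also have "\<dots> = (\<integral>\<^sup>+z. F z \<partial>lborel)"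
    by (subst nn_integral_lborel_complex_swap) auto
  finally show ?thesis .
qed

lemma nn_integral_lborel_shear_Im:
  assumes [measurable]: "F \<in> borel_measurable borel"
  shows "(\<integral>\<^sup>+z. F (Complex (Re z) (Im z + a * Re z)) \<partial>lborel) = (\<integral>\<^sup>+z. F z \<partial>lborel)"
proof -
  have [measurable]: "(\<lambda>z. Complex (Re z) (Im z + a * Re z)) \<in> borel_measurable borel"
    by (intro borel_measurable_continuous_onI continuous_intros)
  have [measurable]: "(\<lambda>y. Complex x y) \<in> borel_measurable borel" for x
    by (intro borel_measurable_continuous_onI continuous_intros)
  have "(\<integral>\<^sup>+z. F (Complex (Re z) (Im z + a * Re z)) \<partial>lborel)
      = (\<integral>\<^sup>+x. \<integral>\<^sup>+y. F (Complex x (y + a * x)) \<partial>lborel \<partial>lborel)"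
    by (subst nn_integral_lborel_complex) auto
  also have "\<dots> = (\<integral>\<^sup>+x. \<integral>\<^sup>+y. F (Complex x y) \<partial>lborel \<partial>lborel)"
    using nn_integral_lborel_translate[of "\<lambda>y. F (Complex x y)" "a * x" for x] by simp
  also have "\<dots> = (\<integral>\<^sup>+z. F z \<partial>lborel)"
    by (subst nn_integral_lborel_complex) auto
  finally show ?thesis .
qed

text \<open>A rotation that is not \<open>\<plusminus> 1\<close> is a product of three shears.\<close>

lemma nn_integral_lborel_rotate:
  assumes [measurable]: "F \<in> borel_measurable borel" and c: "cmod c = 1"
  shows "(\<integral>\<^sup>+z. F (c * z) \<partial>lborel) = (\<integral>\<^sup>+z. F z \<partial>lborel)"
proof -
  have nonreal: "(\<integral>\<^sup>+z. F (c * z) \<partial>lborel) = (\<integral>\<^sup>+z. F z \<partial>lborel)"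
    if F[measurable]: "F \<in> borel_measurable borel" and c: "cmod c = 1" and im: "Im c \<noteq> 0" for F c
  proof -
    \<comment> \<open>\<open>S\<close> and \<open>T\<close> are the shears with matrices (1 s; 0 1)
      and (1 0; q 1). The product S T S has diagonal entries 1 + q s, lower left entry q and upper
      right entry s (2 + q s). It equals the rotation (p -q; q p) exactly when q s = p - 1 and s (1
      + p) = -q; the second relation follows from the first by p^2 + q^2 = 1.\<close>
    define p q s where "p = Re c" and "q = Im c" and "s = (p - 1) / q"
    define S where "S = (\<lambda>z. Complex (Re z + s * Im z) (Im z))"
    define T where "T = (\<lambda>z. Complex (Re z) (Im z + q * Re z))"
    have [measurable]: "S \<in> borel_measurable borel" "T \<in> borel_measurable borel"
      unfolding S_def T_def by (intro borel_measurable_continuous_onI continuous_intros)+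
    have S_def2: "Complex (Re z + s * Im z) (Im z) = S z" for z by (simp add: S_def)
    have T_def2: "Complex (Re z) (Im z + q * Re z) = T z" for z by (simp add: T_def)
    have pq: "p\<^sup>2 + q\<^sup>2 = 1" using c by (simp add: p_def q_def cmod_def)
    have q0: "q \<noteq> 0" using im by (simp add: q_def)
    have qs: "q * s = p - 1" using q0 by (simp add: s_def)
    have sp: "s * (1 + p) = - q" 
      using pq q0 by (simp add: s_def field_simps power2_eq_square)
    have eq: "S (T (S z)) = c * z" for z
    proof (rule complex_eqI)
      have *: "Im (T (S z)) = q * Re z + p * Im z"
        using qs by (simp add: T_def S_def algebra_simps) (metis distrib_right diff_add_cancel mult.assoc mult_1)
      show "Im (S (T (S z))) = Im (c * z)"
        using * by (simp add: S_def p_def q_def)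
      have "Re (S (T (S z))) = Re z + s * Im z + s * (q * Re z + p * Im z)"
        using * by (simp add: S_def T_def)
      also have "\<dots> = (1 + q * s) * Re z + s * (1 + p) * Im z" by (simp add: algebra_simps)
      also have "\<dots> = Re (c * z)" unfolding qs sp by (simp add: p_def q_def)
      finally show "Re (S (T (S z))) = Re (c * z)" .
    qed
    have "(\<integral>\<^sup>+z. F (c * z) \<partial>lborel) = (\<integral>\<^sup>+z. F (S (T (S z))) \<partial>lborel)" by (simp add: eq)
    also have "\<dots> = (\<integral>\<^sup>+z. F (S (T z)) \<partial>lborel)"
      using nn_integral_lborel_shear_Re[of "\<lambda>z. F (S (T z))" s] by (simp add: S_def2)
    also have "\<dots> = (\<integral>\<^sup>+z. F (S z) \<partial>lborel)"
      using nn_integral_lborel_shear_Im[of "\<lambda>z. F (S z)" q] by (simp add: T_def2)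
    also have "\<dots> = (\<integral>\<^sup>+z. F z \<partial>lborel)"
      using nn_integral_lborel_shear_Re[of F s] by (simp add: S_def2)
    finally show ?thesis .
  qed
  show ?thesis
  proof (cases "Im c = 0")
    case True
    then have "c = 1 \<or> c = - 1"
      using c by (auto simp: complex_eq_iff cmod_def)
    \<comment> \<open>The half turn is two quarter turns, and multiplication by \<open>\<i>\<close>
      falls under the nonreal case.\<close>
    moreover have "(\<integral>\<^sup>+z. F (- z) \<partial>lborel) = (\<integral>\<^sup>+z. F z \<partial>lborel)"
      using nonreal[of "\<lambda>z. F (\<i> * z)" \<i>] nonreal[of F \<i>] by (simp flip: mult.assoc)
    ultimately show ?thesis by auto
  qed (auto intro: nonreal c)
qed

subsection \<open>Normalized area measure and radial moments\<close>

text \<open>The measure \<open>dA\<close> extended by zero to the whole plane. Its space is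
  \<open>UNIV\<close> and its sigma-algebra is the Borel one, so measurability is checked on the
  plane rather than on a restricted space.\<close>

definition disc_area :: "complex measure" where
  "disc_area = density lborel (\<lambda>z. ennreal (1 / pi) * indicator (ball 0 1) z)"

lemma sets_disc_area [simp, measurable_cong]: "sets disc_area = sets borel"
  by (simp add: disc_area_def)

lemma space_disc_area [simp]: "space disc_area = UNIV"
  by (simp add: disc_area_def)

lemma nn_integral_disc_area:
  assumes [measurable]: "F \<in> borel_measurable borel"
  shows "(\<integral>\<^sup>+z. F z \<partial>disc_area) = ennreal (1 / pi) * (\<integral>\<^sup>+z. F z * indicator (ball 0 1) z \<partial>lborel)"
proof -
  have [measurable]: "ball (0::complex) 1 \<in> sets borel" by simp
  show ?thesis
    unfolding disc_area_def
    by (subst nn_integral_density) (auto simp: nn_integral_cmult[symmetric] mult_ac)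
qed

lemma AE_disc_area: "AE z in disc_area. z \<in> ball 0 1"
  unfolding disc_area_def by (subst AE_density) (auto simp: indicator_def)

lemma nn_integral_disc_area_cong:
  assumes "\<And>z. cmod z < 1 \<Longrightarrow> F z = G z"
  shows "(\<integral>\<^sup>+z. F z \<partial>disc_area) = (\<integral>\<^sup>+z. G z \<partial>disc_area)"
  by (rule nn_integral_cong_AE, rule eventually_mono[OF AE_disc_area]) (auto intro: assms)

text \<open>Only values on the disc enter, so measurability is asked of the representative
  \<open>F\<close> alone and \<open>G\<close> may be arbitrary outside the disc.\<close>

lemma nn_integral_dA:
  assumes [measurable]: "F \<in> borel_measurable borel"
    and eq: "\<And>z. cmod z < 1 \<Longrightarrow> G z = F z"
  shows "(\<integral>\<^sup>+z. G z \<partial>dA) = (\<integral>\<^sup>+z. F z \<partial>disc_area)"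
proof -
  have [measurable]: "ball (0::complex) 1 \<in> sets borel" by simp
  have "(\<integral>\<^sup>+z. G z \<partial>dA) = (\<integral>\<^sup>+z. F z \<partial>dA)"
    by (rule nn_integral_cong) (auto simp: dA_def space_restrict_space eq)
  also have "\<dots> = (\<integral>\<^sup>+z. ennreal (1 / pi) * F z \<partial>restrict_space lborel (ball 0 1))"
    unfolding dA_def by (subst nn_integral_density) (auto intro!: measurable_restrict_space1)
  also have "\<dots> = (\<integral>\<^sup>+z. F z \<partial>disc_area)"
    by (subst nn_integral_restrict_space, simp, simp add: mult.assoc nn_integral_disc_area nn_integral_cmult)
  finally show ?thesis .
qed

lemma emeasure_disc_area:
  assumes "A \<in> sets borel"
  shows "emeasure disc_area A = ennreal (1 / pi) * emeasure lborel (A \<inter> ball 0 1)"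
proof -
  have "emeasure disc_area A = (\<integral>\<^sup>+z. indicator A z \<partial>disc_area)"
    using assms by simp
  also have "\<dots> = ennreal (1 / pi) * emeasure lborel (A \<inter> ball 0 1)"
    using assms by (subst nn_integral_disc_area) (auto simp: indicator_inter_arith[symmetric])
  finally show ?thesis .
qed

lemma finite_measure_disc_area: "finite_measure disc_area"
  by (rule finite_measureI) (simp add: emeasure_disc_area emeasure_ball ennreal_mult_eq_top_iff)

section \<open>Law of the squared modulus and radial moments\<close>

text \<open>The annulus x < |z|^2 < 1 has normalized area 1 - x, so the squared modulus is uniformly
  distributed on the unit interval. Comparing the two finite laws on half-lines suffices. This
  replaces polar coordinates.\<close>

lemma distr_disc_area_norm_square:
  "distr disc_area borel (\<lambda>z. (cmod z)\<^sup>2) = density lborel (indicator {0..1})"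
proof (rule measure_eqI_lessThan)
  interpret finite_measure disc_area by (rule finite_measure_disc_area)
  fix x :: real
  have 1: "emeasure (distr disc_area borel (\<lambda>z. (cmod z)\<^sup>2)) {x<..}
      = emeasure disc_area {z. x < (cmod z)\<^sup>2}"
    by (subst emeasure_distr) (auto intro!: arg_cong2[where f=emeasure])
  then show "emeasure (distr disc_area borel (\<lambda>z. (cmod z)\<^sup>2)) {x<..} < \<infinity>"
    using emeasure_finite[of "{z. x < (cmod z)\<^sup>2}"] by (simp add: less_top[symmetric])
  have [measurable]: "{z. x < (cmod z)\<^sup>2} \<in> sets borel" by measurable
  have 2: "emeasure (density lborel (indicator {0..1})) {x<..} = emeasure lborel ({0..1} \<inter> {x<..})"
    by (subst emeasure_density) (auto simp: indicator_inter_arith[symmetric])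
  consider "x < 0" | "0 \<le> x" "x \<le> 1" | "1 < x" by linarith
  then have "emeasure disc_area {z. x < (cmod z)\<^sup>2} = emeasure lborel ({0..1} \<inter> {x<..})"
  proof cases
    case 1
    then have "{z. x < (cmod z)\<^sup>2} \<inter> ball 0 1 = ball 0 1" "{0..1} \<inter> {x<..} = {0..1}"
      by (auto intro: less_le_trans)
    then show ?thesis by (simp add: emeasure_disc_area emeasure_ball unit_ball_vol_2 ennreal_mult[symmetric])
  next
    case 2
    have *: "cmod z \<le> sqrt x \<longleftrightarrow> (cmod z)\<^sup>2 \<le> x" for z
      using real_sqrt_le_iff[of "(cmod z)\<^sup>2" x] by simp
    have eq: "{z. x < (cmod z)\<^sup>2} \<inter> ball 0 1 = ball 0 1 - cball 0 (sqrt x)"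
      using * by (auto simp: not_le)
    have "emeasure disc_area {z. x < (cmod z)\<^sup>2} 
        = ennreal (1 / pi) * emeasure lborel (ball 0 1 - cball 0 (sqrt x) :: complex set)"
      by (simp add: emeasure_disc_area eq)
    \<comment> \<open>Passing from the closed to the open inner disc changes the set only by a
      circle, which is null.\<close>
    also have "emeasure lborel (ball 0 1 - cball 0 (sqrt x) :: complex set)
       = emeasure lborel (ball 0 1 - ball 0 (sqrt x) :: complex set)"
    proof (rule emeasure_eq_AE)
      have "sphere 0 (sqrt x) \<in> null_sets (lborel :: complex measure)"
        using negligible_sphere[of "0::complex" "sqrt x"]
        by (auto simp: null_sets_completion_iff negligible_iff_null_sets)
      then have "AE z in (lborel :: complex measure). z \<notin> sphere 0 (sqrt x)" by (rule AE_not_in)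
      then show "AE z in (lborel :: complex measure). z \<in> ball 0 1 - cball 0 (sqrt x) \<longleftrightarrow> z \<in> ball 0 1 - ball 0 (sqrt x)"
        by eventually_elim auto
    qed auto
    also have "\<dots> = ennreal pi - ennreal (pi * x)"
      using 2 by (subst emeasure_Diff) (auto simp: emeasure_ball unit_ball_vol_2 subset_ball)
    also have "ennreal (1 / pi) * \<dots> = ennreal (1 - x)"
      using 2 by (subst ennreal_minus) (auto simp: ennreal_mult[symmetric] field_simps)
    also have "{0..1} \<inter> {x<..} = {x<..1}" using 2 by auto
    then have "ennreal (1 - x) = emeasure lborel ({0..1} \<inter> {x<..})" using 2 by simp
    finally show ?thesis .
  next
    case 3
    have "z \<notin> {z. x < (cmod z)\<^sup>2} \<inter> ball 0 1" for z
      using 3 power_le_one[of "cmod z" 2] by auto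
    then have "{z. x < (cmod z)\<^sup>2} \<inter> ball 0 1 = {}" by auto
    moreover have "{0..1} \<inter> {x<..} = {}" using 3 by auto
    ultimately show ?thesis by (simp add: emeasure_disc_area)
  qed
  then show "emeasure (distr disc_area borel (\<lambda>z. (cmod z)\<^sup>2)) {x<..} 
    = emeasure (density lborel (indicator {0..1})) {x<..}" using 1 2 by simp
qed auto

lemma nn_integral_disc_area_radial:
  assumes [measurable]: "\<phi> \<in> borel_measurable borel"
  shows "(\<integral>\<^sup>+z. \<phi> ((cmod z)\<^sup>2) \<partial>disc_area) = (\<integral>\<^sup>+t. indicator {0..1} t * \<phi> t \<partial>lborel)"
proof -
  have "(\<integral>\<^sup>+z. \<phi> ((cmod z)\<^sup>2) \<partial>disc_area) = (\<integral>\<^sup>+t. \<phi> t \<partial>distr disc_area borel (\<lambda>z. (cmod z)\<^sup>2))"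
    by (subst nn_integral_distr) auto
  also have "\<dots> = (\<integral>\<^sup>+t. indicator {0..1} t * \<phi> t \<partial>lborel)"
    unfolding distr_disc_area_norm_square by (subst nn_integral_density) auto
  finally show ?thesis .
qed

lemma nn_integral_Icc_continuous:
  fixes \<phi> :: "real \<Rightarrow> real"
  assumes cont: "continuous_on UNIV \<phi>" and nonneg: "\<And>t. a \<le> t \<Longrightarrow> t \<le> b \<Longrightarrow> 0 \<le> \<phi> t"
  shows "(\<integral>\<^sup>+t. indicator {a..b} t * ennreal (\<phi> t) \<partial>lborel) = ennreal (integral {a..b} \<phi>)"
proof -
  have [measurable]: "\<phi> \<in> borel_measurable borel" using cont by (rule borel_measurable_continuous_onI)
  have "(\<phi> has_integral integral {a..b} \<phi>) {a..b}"
    by (intro integrable_integral integrable_continuous_real continuous_on_subset[OF cont]) auto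
  then have "((\<lambda>t. indicator {a..b} t * \<phi> t) has_integral integral {a..b} \<phi>) UNIV"
    by (subst (asm) has_integral_restrict_UNIV[symmetric])
       (auto simp: indicator_def if_distrib cong: if_cong elim!: has_integral_eq[rotated])
  then have "(\<integral>\<^sup>+t. ennreal (indicator {a..b} t * \<phi> t) \<partial>lborel) = ennreal (integral {a..b} \<phi>)"
    by (intro nn_integral_has_integral_lborel) (auto simp: nonneg indicator_def)
  moreover have "ennreal (indicator {a..b} t * \<phi> t) = indicator {a..b} t * ennreal (\<phi> t)" for t
    by (simp add: indicator_def)
  ultimately show ?thesis by simp
qed

text \<open>Integrating the derivative of \<open>t ^ Suc j * (1 - t) ^ Suc N\<close> over \<open>{0..1}\<close> gives \<open>0\<close>.\<close>

lemma radial_moment_recurrence: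
  "(\<integral>\<^sup>+z. ennreal (((cmod z)\<^sup>2) ^ Suc j * (1 - (cmod z)\<^sup>2) ^ N) \<partial>disc_area)
    \<le> ennreal (real (Suc j)) * (\<integral>\<^sup>+z. ennreal (((cmod z)\<^sup>2) ^ j * (1 - (cmod z)\<^sup>2) ^ Suc N) \<partial>disc_area)"
proof -
  define A B :: "real \<Rightarrow> real" where "A = (\<lambda>t. t ^ Suc j * (1 - t) ^ N)" and "B = (\<lambda>t. t ^ j * (1 - t) ^ Suc N)"
  have cont: "continuous_on S A" "continuous_on S B" for S
    unfolding A_def B_def by (intro continuous_intros)+
  have int: "A integrable_on {0..1}" "B integrable_on {0..1}"
    by (intro integrable_continuous_real cont)+
  have deriv: "((\<lambda>t. t ^ Suc j * (1 - t) ^ Suc N) has_real_derivative real (Suc j) * B x - real (Suc N) * A x)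
      (at x within S)" for x S
    unfolding A_def B_def
    by (rule DERIV_cong[OF DERIV_mult[OF DERIV_power[OF DERIV_ident]
            DERIV_power[OF DERIV_diff[OF DERIV_const DERIV_ident]]]])
       (simp add: mult_ac del: power_Suc of_nat_Suc)
  have "((\<lambda>t. real (Suc j) * B t - real (Suc N) * A t) has_integral
      ((\<lambda>t. t ^ Suc j * (1 - t) ^ Suc N) 1 - (\<lambda>t. t ^ Suc j * (1 - t) ^ Suc N) 0)) {0..1::real}"
    by (rule fundamental_theorem_of_calculus)
       (auto intro: deriv[unfolded has_real_derivative_iff_has_vector_derivative] simp del: power_Suc of_nat_Suc)
  then have "((\<lambda>t. real (Suc j) * B t - real (Suc N) * A t) has_integral 0) {0..1::real}" by simp
  moreover have "((\<lambda>t. real (Suc j) * B t - real (Suc N) * A t) has_integral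
      (real (Suc j) * integral {0..1} B - real (Suc N) * integral {0..1} A)) {0..1::real}"
    by (intro has_integral_diff has_integral_mult_right integrable_integral int)
  ultimately have "real (Suc j) * integral {0..1} B - real (Suc N) * integral {0..1} A = 0"
    by (rule has_integral_unique[rotated])
  then have eq: "real (Suc j) * integral {0..1} B = real (Suc N) * integral {0..1} A"
    by linarith
  have A0: "0 \<le> integral {0..1} A" by (intro integral_nonneg int) (auto simp: A_def)
  \<comment> \<open>The exact relation carries the factor \<open>Suc N\<close> in front of the
    integral of \<open>A\<close>. Bounding it below by 1 gives an estimate whose constant is
    independent of \<open>N\<close>.\<close>
  then have "integral {0..1} A \<le> real (Suc j) * integral {0..1} B"
    unfolding eq by (simp add: distrib_right)
  then have "ennreal (integral {0..1} A) \<le> ennreal (real (Suc j)) * ennreal (integral {0..1} B)"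
    using A0 by (subst ennreal_mult'[symmetric]) (auto intro!: ennreal_leI)
  moreover have "(\<integral>\<^sup>+z. ennreal (A ((cmod z)\<^sup>2)) \<partial>disc_area) = ennreal (integral {0..1} A)"
    by (subst nn_integral_disc_area_radial[of "\<lambda>t. ennreal (A t)"])
       (auto intro!: nn_integral_Icc_continuous cont borel_measurable_continuous_onI continuous_intros simp: A_def)
  moreover have "(\<integral>\<^sup>+z. ennreal (B ((cmod z)\<^sup>2)) \<partial>disc_area) = ennreal (integral {0..1} B)"
    by (subst nn_integral_disc_area_radial[of "\<lambda>t. ennreal (B t)"])
       (auto intro!: nn_integral_Icc_continuous cont borel_measurable_continuous_onI continuous_intros simp: B_def)
  ultimately show ?thesis by (simp add: A_def B_def)
qed

text \<open>The squared norm of z^m in the Bergman space with weight (1 - |z|^2)^n; with t = |z|^2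
  it is the Beta value B(m + 1, n + 1).\<close>

definition bergman_moment :: "nat \<Rightarrow> nat \<Rightarrow> ennreal" where
  "bergman_moment n m = (\<integral>\<^sup>+z. ennreal (((cmod z)\<^sup>2) ^ m * (1 - (cmod z)\<^sup>2) ^ n) \<partial>disc_area)"

text \<open>Pointwise, the geometric tail x^(j+1) / (1 - x) with x = |z|^2 cancels one power of the
  weight. What remains is exactly the left side of \<open>radial_moment_recurrence\<close>.\<close>

lemma bergman_moment_tail:
  "(\<Sum>m. if j < m then bergman_moment (Suc N) m else 0) \<le> ennreal (real (Suc j)) * bergman_moment (Suc N) j"
proof -
  have "(\<Sum>m. if j < m then bergman_moment (Suc N) m else 0)
      = (\<Sum>m. \<integral>\<^sup>+z. (if j < m then ennreal (((cmod z)\<^sup>2) ^ m * (1 - (cmod z)\<^sup>2) ^ Suc N) else 0) \<partial>disc_area)"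
    by (intro suminf_cong) (simp add: bergman_moment_def)
  also have "\<dots> = (\<integral>\<^sup>+z. (\<Sum>m. if j < m then ennreal (((cmod z)\<^sup>2) ^ m * (1 - (cmod z)\<^sup>2) ^ Suc N) else 0) \<partial>disc_area)"
    by (subst nn_integral_suminf) auto
  also have "\<dots> = (\<integral>\<^sup>+z. ennreal (((cmod z)\<^sup>2) ^ Suc j * (1 - (cmod z)\<^sup>2) ^ N) \<partial>disc_area)"
  proof (rule nn_integral_disc_area_cong)
    fix z :: complex assume z: "cmod z < 1"
    define x where "x = (cmod z)\<^sup>2"
    have x: "0 \<le> x" "x < 1" using z by (auto simp: x_def power_less_one_iff abs_square_less_1)
    have "(\<lambda>i. x ^ Suc j * (1 - x) ^ Suc N * x ^ i) sums (x ^ Suc j * (1 - x) ^ Suc N * (1 / (1 - x)))"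
      using x by (intro sums_mult geometric_sums) auto
    moreover have "x ^ Suc j * (1 - x) ^ Suc N * (1 / (1 - x)) = x ^ Suc j * (1 - x) ^ N"
      using x by simp
    moreover have "x ^ Suc j * (1 - x) ^ Suc N * x ^ i = x ^ (i + Suc j) * (1 - x) ^ Suc N" for i
      by (simp only: power_add mult_ac)
    ultimately have "(\<lambda>i. x ^ (i + Suc j) * (1 - x) ^ Suc N) sums (x ^ Suc j * (1 - x) ^ N)"
      by (simp only:)
    then have "(\<lambda>i. (if j < i + Suc j then x ^ (i + Suc j) * (1 - x) ^ Suc N else 0)) sums (x ^ Suc j * (1 - x) ^ N)"
      by simp
    then have "(\<lambda>m. (if j < m then x ^ m * (1 - x) ^ Suc N else 0)) sums (x ^ Suc j * (1 - x) ^ N)"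
      by (subst (asm) sums_iff_shift) simp
    then have "(\<lambda>m. ennreal (if j < m then x ^ m * (1 - x) ^ Suc N else 0)) sums ennreal (x ^ Suc j * (1 - x) ^ N)"
      using x by (subst sums_ennreal) auto
    then have "(\<Sum>m. ennreal (if j < m then x ^ m * (1 - x) ^ Suc N else 0)) = ennreal (x ^ Suc j * (1 - x) ^ N)"
      by (rule sums_unique[symmetric])
    then show "(\<Sum>m. if j < m then ennreal (((cmod z)\<^sup>2) ^ m * (1 - (cmod z)\<^sup>2) ^ Suc N) else 0)
      = ennreal (((cmod z)\<^sup>2) ^ Suc j * (1 - (cmod z)\<^sup>2) ^ N)"
      by (simp add: x_def if_distrib cong: if_cong)
  qed
  also have "\<dots> \<le> ennreal (real (Suc j)) * bergman_moment (Suc N) j"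
    unfolding bergman_moment_def by (rule radial_moment_recurrence)
  finally show ?thesis .
qed

subsection \<open>Parseval identities\<close>

lemma has_integral_cis_power:
  assumes "k > 0"
  shows "((\<lambda>\<theta>. cis \<theta> ^ k) has_integral 0) {0..2 * pi}"
proof -
  have "((\<lambda>\<theta>. cis \<theta> ^ k) has_integral (cis (real k * (2 * pi)) / (\<i> * k) - cis (real k * 0) / (\<i> * k))) {0..2 * pi}"
  proof (rule fundamental_theorem_of_calculus)
    fix x :: real
    have "((\<lambda>\<theta>. cis (real k * \<theta>)) has_vector_derivative real k *\<^sub>R (\<i> * cis (real k * x))) (at x within {0..2 * pi})"
      by (rule vector_diff_chain_within[of "\<lambda>t. real k * t" "real k" x "{0..2 * pi}" cis "\<i> * cis (real k * x)", unfolded o_def])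
         (auto intro!: derivative_eq_intros simp: cis_conv_exp has_vector_derivative_def scaleR_conv_of_real mult_ac)
    from has_vector_derivative_divide[OF this, of "\<i> * k"] 
    show "((\<lambda>\<theta>. cis (real k * \<theta>) / (\<i> * k)) has_vector_derivative cis x ^ k) (at x within {0..2 * pi})"
      using assms by (simp add: scaleR_conv_of_real Complex.DeMoivre)
  qed simp
  moreover have "cis (real k * (2 * pi)) = 1"
    using cis_multiple_2pi[of "real k"] by (simp add: mult_ac)
  ultimately show ?thesis by simp
qed

text \<open>Appending a term of degree N produces cross terms with the lower degrees m. On the
  circle they are multiples of \<open>cis \<theta> ^ (N - m)\<close> with a positive exponent, and
  these integrate to zero.\<close>

lemma circle_parseval_polynomial:
  "((\<lambda>\<theta>. (cmod (\<Sum>m<N. c m * cis \<theta> ^ m))\<^sup>2) has_integral (2 * pi * (\<Sum>m<N. (cmod (c m))\<^sup>2))) {0..2 * pi}"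
proof (induction N)
  case (Suc N)
  have cross: "cnj (\<Sum>m<N. c m * cis \<theta> ^ m) * (c N * cis \<theta> ^ N)
      = (\<Sum>m<N. cnj (c m) * c N * cis \<theta> ^ (N - m))" for \<theta>
  proof -
    have "cnj (c m * cis \<theta> ^ m) * (c N * cis \<theta> ^ N) = cnj (c m) * c N * cis \<theta> ^ (N - m)" if "m < N" for m
    proof -
      have "cis \<theta> ^ N = cis \<theta> ^ m * cis \<theta> ^ (N - m)" using that by (simp flip: power_add)
      moreover have "cnj (cis \<theta> ^ m) * cis \<theta> ^ m = 1"
        by (simp add: Complex.DeMoivre cis_cnj cis_mult)
      ultimately show ?thesis by (simp add: algebra_simps)
    qed
    then show ?thesis unfolding cnj_sum sum_distrib_right by (intro sum.cong) auto
  qed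
  have "((\<lambda>\<theta>. \<Sum>m<N. cnj (c m) * c N * cis \<theta> ^ (N - m)) has_integral (\<Sum>m<N. cnj (c m) * c N * 0)) {0..2 * pi}"
    by (intro has_integral_sum has_integral_mult_right has_integral_cis_power) auto
  from has_integral_Re[OF this]
  have "((\<lambda>\<theta>. Re (cnj (\<Sum>m<N. c m * cis \<theta> ^ m) * (c N * cis \<theta> ^ N))) has_integral 0) {0..2 * pi}"
    unfolding cross by simp
  then have "((\<lambda>\<theta>. (cmod (\<Sum>m<N. c m * cis \<theta> ^ m))\<^sup>2 + (cmod (c N))\<^sup>2
       + 2 * Re (cnj (\<Sum>m<N. c m * cis \<theta> ^ m) * (c N * cis \<theta> ^ N))) has_integral
       (2 * pi * (\<Sum>m<N. (cmod (c m))\<^sup>2) + (2 * pi - 0) *\<^sub>R (cmod (c N))\<^sup>2 + 2 * 0)) {0..2 * pi}"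
    by (intro has_integral_add has_integral_mult_right Suc.IH) 
       (use has_integral_const_real[of "(cmod (c N))\<^sup>2" 0 "2 * pi"] in auto)
  moreover have "(cmod (\<Sum>m<Suc N. c m * cis \<theta> ^ m))\<^sup>2 = (cmod (\<Sum>m<N. c m * cis \<theta> ^ m))\<^sup>2 + (cmod (c N))\<^sup>2
       + 2 * Re (cnj (\<Sum>m<N. c m * cis \<theta> ^ m) * (c N * cis \<theta> ^ N))" for \<theta>
  proof -
    have *: "(cmod (x + y))\<^sup>2 = (cmod x)\<^sup>2 + (cmod y)\<^sup>2 + 2 * Re (cnj x * y)" for x y
      unfolding cmod_power2 by (simp add: power2_eq_square algebra_simps)
    show ?thesis unfolding sum.lessThan_Suc * by (simp add: norm_mult norm_power)
  qed
  ultimately show ?case by (simp add: distrib_left)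
qed simp

text \<open>Absolute summability makes the partial sums converge uniformly in the angle, so the
  polynomial identity passes to the limit under the integral.\<close>

lemma circle_parseval:
  assumes c: "summable (\<lambda>m. cmod (c m))"
  shows "(\<integral>\<^sup>+\<theta>. indicator {0..2 * pi} \<theta> * ennreal ((cmod (\<Sum>m. c m * cis \<theta> ^ m))\<^sup>2) \<partial>lborel)
      = ennreal (2 * pi) * (\<Sum>m. ennreal ((cmod (c m))\<^sup>2))"
proof -
  define S where "S = (\<lambda>N \<theta>. \<Sum>m<N. c m * cis \<theta> ^ m)"
  define L where "L = (\<lambda>\<theta>. \<Sum>m. c m * cis \<theta> ^ m)"
  have u: "uniform_limit UNIV S L sequentially"
    unfolding S_def L_def by (rule Weierstrass_m_test[OF _ c]) (simp add: norm_mult norm_power)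
  have contS: "continuous_on A (S N)" for A N
    unfolding S_def by (intro continuous_intros)
  have contL: "continuous_on UNIV L"
    by (rule uniform_limit_theorem[OF always_eventually u]) (auto intro: contS)
  have bL: "bounded (L ` {0..2 * pi})"
    by (intro compact_imp_bounded compact_continuous_image continuous_on_subset[OF contL]) auto
  have u': "uniform_limit {0..2 * pi} S L sequentially"
    by (rule uniform_limit_on_subset[OF u]) auto
  \<comment> \<open>The squared modulus is written as a product with the conjugate. Uniform limits
    are compatible with products because the limit functions are bounded on the compact
    interval.\<close>
  have "uniform_limit {0..2 * pi} (\<lambda>N \<theta>. S N \<theta> * cnj (S N \<theta>)) (\<lambda>\<theta>. L \<theta> * cnj (L \<theta>)) sequentially"
  proof (rule bounded_bilinear.bounded_uniform_limit[OF bounded_bilinear_mult u'])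
    show "uniform_limit {0..2 * pi} (\<lambda>N \<theta>. cnj (S N \<theta>)) (\<lambda>\<theta>. cnj (L \<theta>)) sequentially"
      by (rule bounded_linear.uniform_limit[OF bounded_linear_cnj u'])
    show "bounded ((\<lambda>\<theta>. cnj (L \<theta>)) ` {0..2 * pi})"
      using bL by (auto simp: bounded_iff)
  qed (rule bL)
  then have "uniform_limit {0..2 * pi} (\<lambda>N \<theta>. Re (S N \<theta> * cnj (S N \<theta>))) (\<lambda>\<theta>. Re (L \<theta> * cnj (L \<theta>))) sequentially"
    by (rule bounded_linear.uniform_limit[OF bounded_linear_Re])
  then have u2: "uniform_limit {0..2 * pi} (\<lambda>N \<theta>. (cmod (S N \<theta>))\<^sup>2) (\<lambda>\<theta>. (cmod (L \<theta>))\<^sup>2) sequentially"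
    by (simp add: complex_mult_cnj cmod_power2)
  obtain I J where IJ: "\<And>N. ((\<lambda>\<theta>. (cmod (S N \<theta>))\<^sup>2) has_integral I N) {0..2 * pi}"
    "((\<lambda>\<theta>. (cmod (L \<theta>))\<^sup>2) has_integral J) {0..2 * pi}" "I \<longlonglongrightarrow> J"
    by (rule uniform_limit_integral[OF u2]) (auto intro!: continuous_intros contS)
  have "I = (\<lambda>N. 2 * pi * (\<Sum>m<N. (cmod (c m))\<^sup>2))"
    using has_integral_unique[OF IJ(1)[unfolded S_def] circle_parseval_polynomial] by auto
  then have "(\<lambda>N. \<Sum>m<N. 2 * pi * (cmod (c m))\<^sup>2) \<longlonglongrightarrow> J"
    using IJ(3) by (simp add: sum_distrib_left)
  then have "(\<lambda>m. 2 * pi * (cmod (c m))\<^sup>2) sums J" by (simp add: sums_def)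
  then have "(\<lambda>m. ennreal (2 * pi * (cmod (c m))\<^sup>2)) sums ennreal J"
    by (subst sums_ennreal) (auto intro: has_integral_nonneg[OF IJ(2)])
  then have "(\<Sum>m. ennreal (2 * pi) * ennreal ((cmod (c m))\<^sup>2)) = ennreal J"
    by (simp add: sums_iff ennreal_mult')
  then have J: "ennreal (2 * pi) * (\<Sum>m. ennreal ((cmod (c m))\<^sup>2)) = ennreal J"
    by simp
  have "(\<integral>\<^sup>+\<theta>. indicator {0..2 * pi} \<theta> * ennreal ((cmod (L \<theta>))\<^sup>2) \<partial>lborel)
      = ennreal (integral {0..2 * pi} (\<lambda>\<theta>. (cmod (L \<theta>))\<^sup>2))"
    by (rule nn_integral_Icc_continuous) (auto intro!: continuous_intros contL)
  then show ?thesis using J integral_unique[OF IJ(2)] by (simp add: L_def)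
qed

section \<open>Parseval on the disc for radial weights\<close>

lemma nn_integral_disc_area_rotate:
  assumes [measurable]: "F \<in> borel_measurable borel" and c: "cmod c = 1"
  shows "(\<integral>\<^sup>+z. F (c * z) \<partial>disc_area) = (\<integral>\<^sup>+z. F z \<partial>disc_area)"
proof -
  have [measurable]: "ball (0::complex) 1 \<in> sets borel" by simp
  have "indicator (ball 0 1) (c * z) = (indicator (ball 0 1) z :: ennreal)" for z
    using c by (simp add: indicator_def norm_mult)
  then show ?thesis
    using nn_integral_lborel_rotate[of "\<lambda>z. F z * indicator (ball 0 1) z" c] c
    by (simp add: nn_integral_disc_area)
qed

text \<open>By rotation invariance the area integral may be averaged over all rotations. After
  exchanging the integrals, the inner one runs over the circle through z, where
  \<open>circle_parseval\<close> applies to the coefficients a_m z^m. Everything takes values in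
  [0, \<infinity>], so divergent cases are included.\<close>

lemma disc_parseval:
  assumes a: "\<And>z. cmod z < 1 \<Longrightarrow> summable (\<lambda>m. a m * z ^ m)"
    and W[measurable]: "W \<in> borel_measurable borel"
  shows "(\<integral>\<^sup>+z. ennreal ((cmod (\<Sum>m. a m * z ^ m))\<^sup>2) * W (cmod z) \<partial>disc_area)
      = (\<Sum>m. ennreal ((cmod (a m))\<^sup>2) * (\<integral>\<^sup>+z. ennreal (((cmod z)\<^sup>2) ^ m) * W (cmod z) \<partial>disc_area))"
proof -
  interpret D: finite_measure disc_area by (rule finite_measure_disc_area)
  interpret pair_sigma_finite disc_area "lborel :: real measure" ..
  define F where "F = (\<lambda>z. ennreal ((cmod (\<Sum>m. a m * z ^ m))\<^sup>2) * W (cmod z))"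
  define I where "I = (indicator {0..2 * pi} :: real \<Rightarrow> ennreal)"
  have [measurable]: "I \<in> borel_measurable borel" by (simp add: I_def)
  have [measurable]: "cis \<in> borel_measurable borel"
    by (intro borel_measurable_continuous_onI continuous_intros)
  have F[measurable]: "F \<in> borel_measurable borel" unfolding F_def by measurable
  \<comment> \<open>The factor is the length of the angle interval; it returns from the circle
    identity and is cancelled at the end.\<close>
  have "ennreal (2 * pi) * (\<integral>\<^sup>+z. F z \<partial>disc_area) = (\<integral>\<^sup>+\<theta>. I \<theta> * (\<integral>\<^sup>+z. F z \<partial>disc_area) \<partial>lborel)"
    by (subst nn_integral_multc) (auto simp: I_def)
  also have "\<dots> = (\<integral>\<^sup>+\<theta>. \<integral>\<^sup>+z. I \<theta> * F (cis \<theta> * z) \<partial>disc_area \<partial>lborel)"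
    by (intro nn_integral_cong) (simp add: nn_integral_cmult nn_integral_disc_area_rotate)
  also have "\<dots> = (\<integral>\<^sup>+z. \<integral>\<^sup>+\<theta>. I \<theta> * F (cis \<theta> * z) \<partial>lborel \<partial>disc_area)"
    by (rule Fubini') simp
  also have "\<dots> = (\<integral>\<^sup>+z. ennreal (2 * pi) * (\<Sum>m. ennreal ((cmod (a m))\<^sup>2) * (ennreal (((cmod z)\<^sup>2) ^ m) * W (cmod z))) \<partial>disc_area)"
  proof (rule nn_integral_disc_area_cong)
    fix z :: complex assume z: "cmod z < 1"
    \<comment> \<open>Convergence at an intermediate radius \<open>R\<close> yields absolute
      convergence at the smaller modulus of z.\<close>
    obtain R where R: "cmod z < R" "R < 1" using z dense by blast
    then have R0: "0 \<le> R" using norm_ge_zero[of z] by linarith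
    have "summable (\<lambda>m. a m * complex_of_real R ^ m)" using R R0 by (intro a) simp
    then have "summable (\<lambda>m. norm (a m * z ^ m))"
      by (rule powser_insidea) (use R R0 in simp)
    note cp = circle_parseval[OF this]
    have "(\<integral>\<^sup>+\<theta>. I \<theta> * F (cis \<theta> * z) \<partial>lborel)
        = (\<integral>\<^sup>+\<theta>. (I \<theta> * ennreal ((cmod (\<Sum>m. a m * z ^ m * cis \<theta> ^ m))\<^sup>2)) * W (cmod z) \<partial>lborel)"
      by (intro nn_integral_cong) (simp add: F_def norm_mult power_mult_distrib mult_ac)
    also have "\<dots> = ennreal (2 * pi) * (\<Sum>m. ennreal ((cmod (a m * z ^ m))\<^sup>2)) * W (cmod z)"
      by (subst nn_integral_multc) (use cp in \<open>auto simp: I_def\<close>)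
    also have "\<dots> = ennreal (2 * pi) * (\<Sum>m. ennreal ((cmod (a m))\<^sup>2) * (ennreal (((cmod z)\<^sup>2) ^ m) * W (cmod z)))"
      by (simp add: norm_mult norm_power power_mult_distrib ennreal_mult' mult_ac power_mult[symmetric] flip: ennreal_suminf_multc)
    finally show "(\<integral>\<^sup>+\<theta>. I \<theta> * F (cis \<theta> * z) \<partial>lborel) = \<dots>" .
  qed
  also have "\<dots> = ennreal (2 * pi) * (\<Sum>m. ennreal ((cmod (a m))\<^sup>2) * (\<integral>\<^sup>+z. ennreal (((cmod z)\<^sup>2) ^ m) * W (cmod z) \<partial>disc_area))"
    by (simp add: nn_integral_cmult nn_integral_suminf)
  finally show ?thesis
    unfolding F_def by (simp add: ennreal_mult_cancel_left)
qed

lemma bergman_norm: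
  assumes "\<And>z. cmod z < 1 \<Longrightarrow> (\<lambda>m. a m * z ^ m) sums h z"
  shows "(\<integral>\<^sup>+z. ennreal ((cmod (h z))\<^sup>2 * (1 - (cmod z)\<^sup>2) ^ n) \<partial>disc_area)
      = (\<Sum>m. ennreal ((cmod (a m))\<^sup>2) * bergman_moment n m)"
proof -
  have "(\<integral>\<^sup>+z. ennreal ((cmod (h z))\<^sup>2 * (1 - (cmod z)\<^sup>2) ^ n) \<partial>disc_area)
      = (\<integral>\<^sup>+z. ennreal ((cmod (\<Sum>m. a m * z ^ m))\<^sup>2) * ennreal ((1 - (cmod z)\<^sup>2) ^ n) \<partial>disc_area)"
    by (rule nn_integral_disc_area_cong) (use assms in \<open>auto simp: sums_iff ennreal_mult'\<close>)
  also have "\<dots> = (\<Sum>m. ennreal ((cmod (a m))\<^sup>2) * (\<integral>\<^sup>+z. ennreal (((cmod z)\<^sup>2) ^ m) * ennreal ((1 - (cmod z)\<^sup>2) ^ n) \<partial>disc_area))"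
    by (rule disc_parseval[where W = "\<lambda>x. ennreal ((1 - x\<^sup>2) ^ n)"]) (use assms in \<open>auto simp: sums_iff\<close>)
  finally show ?thesis
    by (simp add: bergman_moment_def ennreal_mult')
qed

subsection \<open>Coefficients of the dilated function\<close>

text \<open>Tonelli for the counting measure on the naturals.\<close>

lemma ennreal_suminf_swap:
  fixes f :: "nat \<Rightarrow> nat \<Rightarrow> ennreal"
  shows "(\<Sum>m. \<Sum>j. f m j) = (\<Sum>j. \<Sum>m. f m j)"
  using nn_integral_suminf[of "\<lambda>j m. f m j" "count_space UNIV"]
  by (simp add: nn_integral_count_space_nat)

text \<open>If a_m are the coefficients of h(z) = g(z) / (1 - \<omega> z), these are the
  coefficients of g(rz) / (1 - \<omega> z). The diagonal term stands apart because r r^m + (1 - r)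
  r^m = r^m.\<close>

definition dilation_coeff :: "complex \<Rightarrow> real \<Rightarrow> (nat \<Rightarrow> complex) \<Rightarrow> nat \<Rightarrow> complex" where
  "dilation_coeff \<omega> r a m =
     of_real (r ^ m) * a m + of_real (1 - r) * (\<Sum>j<m. of_real (r ^ j) * \<omega> ^ (m - j) * a j)"

text \<open>The target function is r h(rz) + (1 - r) h(rz) / (1 - \<omega> z). The second summand is
  expanded as the Cauchy product of the series of h(rz) with a geometric series, both absolutely
  convergent.\<close>

lemma sums_dilation_coeff:
  assumes h: "\<And>z. cmod z < 1 \<Longrightarrow> (\<lambda>m. a m * z ^ m) sums (g z / (1 - \<omega> * z))"
    and \<omega>: "cmod \<omega> = 1" and r: "0 \<le> r" "r < 1" and z: "cmod z < 1"
  shows "(\<lambda>m. dilation_coeff \<omega> r a m * z ^ m) sums (g (of_real r * z) / (1 - \<omega> * z))"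
proof -
  define w where "w = of_real r * z"
  define e where "e = (\<lambda>m. a m * w ^ m)"
  have w: "cmod w < 1"
    using r z mult_strict_mono'[of r 1 "cmod z" 1] by (simp add: w_def norm_mult)
  have \<omega>z: "cmod (\<omega> * z) < 1" using \<omega> z by (simp add: norm_mult)
  have ne: "1 - \<omega> * z \<noteq> 0" "1 - \<omega> * w \<noteq> 0"
    using \<omega>z w \<omega> norm_mult[of \<omega> w] by (auto simp: right_minus_eq dest: arg_cong[of _ _ cmod])
  obtain R where R: "cmod w < R" "R < 1" using w dense by blast
  then have R0: "0 \<le> R" using norm_ge_zero[of w] by linarith
  have "summable (\<lambda>m. a m * complex_of_real R ^ m)"
    using h[of "complex_of_real R"] R R0 by (auto simp: sums_iff)
  then have se: "summable (\<lambda>m. norm (e m))"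
    unfolding e_def by (rule powser_insidea) (use R R0 in simp)
  have sb: "summable (\<lambda>m. norm ((\<omega> * z) ^ m))"
    unfolding norm_power by (rule summable_geometric) (use \<omega>z in simp)
  have E: "e sums (g w / (1 - \<omega> * w))" unfolding e_def by (rule h[OF w])
  have "(\<lambda>m. \<Sum>i\<le>m. e i * (\<omega> * z) ^ (m - i)) sums (g w / (1 - \<omega> * w) * (1 / (1 - \<omega> * z)))"
    using Cauchy_product_sums[OF se sb] suminf_geometric[OF \<omega>z] E by (simp add: sums_iff)
  from sums_add[OF sums_mult[OF E, of "of_real r"] sums_mult[OF this, of "of_real (1 - r)"]]
  have "(\<lambda>m. of_real r * e m + of_real (1 - r) * (\<Sum>i\<le>m. e i * (\<omega> * z) ^ (m - i))) sums
     (of_real r * (g w / (1 - \<omega> * w)) + of_real (1 - r) * (g w / (1 - \<omega> * w) * (1 / (1 - \<omega> * z))))" .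
  also have "(\<lambda>m. of_real r * e m + of_real (1 - r) * (\<Sum>i\<le>m. e i * (\<omega> * z) ^ (m - i)))
     = (\<lambda>m. dilation_coeff \<omega> r a m * z ^ m)"
  proof
    fix m
    have "e i * (\<omega> * z) ^ (m - i) = of_real (r ^ i) * \<omega> ^ (m - i) * a i * z ^ m" if "i < m" for i
    proof -
      have "z ^ m = z ^ i * z ^ (m - i)" using that by (simp flip: power_add)
      then show ?thesis by (simp add: e_def w_def power_mult_distrib mult_ac)
    qed
    then have "(\<Sum>i\<le>m. e i * (\<omega> * z) ^ (m - i)) = e m + (\<Sum>j<m. of_real (r ^ j) * \<omega> ^ (m - j) * a j) * z ^ m"
      unfolding lessThan_Suc_atMost[symmetric] sum.lessThan_Suc sum_distrib_right by simp
    then show "of_real r * e m + of_real (1 - r) * (\<Sum>i\<le>m. e i * (\<omega> * z) ^ (m - i)) = dilation_coeff \<omega> r a m * z ^ m"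
      by (simp add: dilation_coeff_def e_def w_def power_mult_distrib algebra_simps)
  qed
  also have "of_real r * (g w / (1 - \<omega> * w)) + of_real (1 - r) * (g w / (1 - \<omega> * w) * (1 / (1 - \<omega> * z)))
     = g w / (1 - \<omega> * w) * ((1 - \<omega> * w) / (1 - \<omega> * z))"
    using ne(1) by (simp add: w_def divide_simps) (simp add: algebra_simps)
  also have "\<dots> = g w / (1 - \<omega> * z)" using ne by simp
  finally show ?thesis by (simp add: w_def)
qed

text \<open>Up to unimodular factors, \<open>dilation_coeff \<omega> r a m\<close> is a convex combination of \<open>a 0, \<dots>, a m\<close>.\<close>

lemma norm_dilation_coeff_le:
  assumes \<omega>: "cmod \<omega> = 1" and r: "0 \<le> r" "r < 1"
  shows "(cmod (dilation_coeff \<omega> r a m))\<^sup>2 \<le> r ^ m * (cmod (a m))\<^sup>2 + (\<Sum>j<m. (1 - r) * r ^ j * (cmod (a j))\<^sup>2)"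
proof -
  \<comment> \<open>These weights are nonnegative, and the geometric sum (1 - r) (1 + ... + r^(m-1))
    = 1 - r^m gives them total mass 1, as Jensen's inequality for the square requires.\<close>
  define w where "w = (\<lambda>j. if j = m then r ^ m else (1 - r) * r ^ j)"
  have w0: "0 \<le> w j" for j using r by (simp add: w_def)
  have split: "(\<Sum>j\<le>m. w j * f j) = r ^ m * f m + (\<Sum>j<m. (1 - r) * r ^ j * f j)" for f :: "nat \<Rightarrow> real"
    unfolding lessThan_Suc_atMost[symmetric] sum.lessThan_Suc by (simp add: w_def)
  have w1: "(\<Sum>j\<le>m. w j) = 1"
    using split[of "\<lambda>_. 1"] one_diff_power_eq[of r m] by (simp add: sum_distrib_left)
  have "cmod (\<Sum>j<m. of_real (r ^ j) * \<omega> ^ (m - j) * a j) \<le> (\<Sum>j<m. r ^ j * cmod (a j))"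
    by (rule order_trans[OF norm_sum]) (use \<omega> r in \<open>simp add: norm_mult norm_power\<close>)
  then have "(1 - r) * cmod (\<Sum>j<m. of_real (r ^ j) * \<omega> ^ (m - j) * a j) \<le> (\<Sum>j<m. (1 - r) * r ^ j * cmod (a j))"
    using r by (simp add: mult.assoc mult_left_mono flip: sum_distrib_left)
  moreover have "cmod (dilation_coeff \<omega> r a m) 
      \<le> r ^ m * cmod (a m) + (1 - r) * cmod (\<Sum>j<m. of_real (r ^ j) * \<omega> ^ (m - j) * a j)"
    unfolding dilation_coeff_def
    by (rule order_trans[OF norm_triangle_ineq]) (use r in \<open>simp add: norm_mult norm_power del: of_real_diff of_real_power\<close>)
  ultimately have "cmod (dilation_coeff \<omega> r a m) \<le> (\<Sum>j\<le>m. w j * cmod (a j))"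
    unfolding split by linarith
  then have "(cmod (dilation_coeff \<omega> r a m))\<^sup>2 \<le> (\<Sum>j\<le>m. w j * cmod (a j))\<^sup>2"
    by (intro power_mono) auto
  also have "\<dots> \<le> (\<Sum>j\<le>m. w j * (cmod (a j))\<^sup>2)"
    using convex_on_sum[OF _ _ convex_power2, of "{..m}" w "\<lambda>j. cmod (a j)"] w0 w1 by simp
  finally show ?thesis unfolding split .
qed

section \<open>Summation of the coefficient bounds\<close>

text \<open>The left side is non-increasing in j: consecutive values differ by r^j (1 - r)^2 (j +
  2). Its value at j = 0 is 2 - r, which is the origin of that constant.\<close>

lemma dilation_weight_le:
  fixes r :: real
  assumes r: "0 \<le> r" "r < 1"
  shows "r ^ j * (1 + (1 - r) * real (Suc j)) \<le> 2 - r"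
proof (induction j)
  case (Suc j)
  have "0 \<le> (1 - r)\<^sup>2 * real (j + 2)" by simp
  also have "\<dots> = (1 + (1 - r) * real (Suc j)) - r * (1 + (1 - r) * real (Suc (Suc j)))"
    by (simp add: power2_eq_square algebra_simps)
  finally have "r * (1 + (1 - r) * real (Suc (Suc j))) \<le> 1 + (1 - r) * real (Suc j)" by simp
  then have "r ^ j * (r * (1 + (1 - r) * real (Suc (Suc j)))) \<le> r ^ j * (1 + (1 - r) * real (Suc j))"
    using r by (intro mult_left_mono) auto
  with Suc.IH show ?case by (simp add: mult_ac)
qed simp

text \<open>After the convexity bound and an exchange of sums, |a_j|^2 carries the weight r^j
  \<gamma>_j plus (1 - r) r^j times the tail of the moments beyond j. The tail is at most (j + 1)
  \<gamma>_j, so \<open>dilation_weight_le\<close> bounds the total by (2 - r) \<gamma>_j.\<close>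

lemma bergman_dilation_le:
  assumes \<omega>: "cmod \<omega> = 1" and r: "0 \<le> r" "r < 1"
  shows "(\<Sum>m. ennreal ((cmod (dilation_coeff \<omega> r a m))\<^sup>2) * bergman_moment (Suc N) m)
    \<le> ennreal (2 - r) * (\<Sum>m. ennreal ((cmod (a m))\<^sup>2) * bergman_moment (Suc N) m)"
proof -
  define \<gamma> where "\<gamma> = bergman_moment (Suc N)"
  define u where "u = (\<lambda>j. (cmod (a j))\<^sup>2)"
  define b where "b = (\<lambda>j. ennreal ((1 - r) * r ^ j * u j))"
  have u0: "0 \<le> u j" for j by (simp add: u_def)
  have "ennreal ((cmod (dilation_coeff \<omega> r a m))\<^sup>2) * \<gamma> m
      \<le> ennreal (r ^ m * u m) * \<gamma> m + (\<Sum>j. b j * (if j < m then \<gamma> m else 0))" for m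
  proof -
    have "ennreal ((cmod (dilation_coeff \<omega> r a m))\<^sup>2) \<le> ennreal (r ^ m * u m + (\<Sum>j<m. (1 - r) * r ^ j * u j))"
      unfolding u_def by (intro ennreal_leI norm_dilation_coeff_le \<omega> r)
    also have "\<dots> = ennreal (r ^ m * u m) + (\<Sum>j<m. b j)"
      using r u0 by (subst ennreal_plus) (auto simp: b_def sum_nonneg sum_ennreal)
    finally have "ennreal ((cmod (dilation_coeff \<omega> r a m))\<^sup>2) * \<gamma> m \<le> (ennreal (r ^ m * u m) + (\<Sum>j<m. b j)) * \<gamma> m"
      by (rule mult_right_mono) simp
    also have "\<dots> = ennreal (r ^ m * u m) * \<gamma> m + (\<Sum>j<m. b j * \<gamma> m)"
      by (simp add: distrib_right sum_distrib_right)
    \<comment> \<open>The condition j < m moves into the summand, so that both indices run over all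
      naturals and the sums can be exchanged.\<close>
    also have "(\<Sum>j<m. b j * \<gamma> m) = (\<Sum>j. b j * (if j < m then \<gamma> m else 0))"
      by (subst suminf_finite[of "{..<m}"]) auto
    finally show ?thesis .
  qed
  then have "(\<Sum>m. ennreal ((cmod (dilation_coeff \<omega> r a m))\<^sup>2) * \<gamma> m)
      \<le> (\<Sum>m. ennreal (r ^ m * u m) * \<gamma> m + (\<Sum>j. b j * (if j < m then \<gamma> m else 0)))"
    by (intro suminf_le) auto
  also have "\<dots> = (\<Sum>m. ennreal (r ^ m * u m) * \<gamma> m) + (\<Sum>m. \<Sum>j. b j * (if j < m then \<gamma> m else 0))"
    by (subst suminf_add) auto
  also have "(\<Sum>m. \<Sum>j. b j * (if j < m then \<gamma> m else 0)) = (\<Sum>j. b j * (\<Sum>m. if j < m then \<gamma> m else 0))"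
    by (subst ennreal_suminf_swap) simp
  also have "\<dots> \<le> (\<Sum>j. b j * (ennreal (real (Suc j)) * \<gamma> j))"
    unfolding \<gamma>_def by (intro suminf_le mult_left_mono bergman_moment_tail) auto
  also have "(\<Sum>m. ennreal (r ^ m * u m) * \<gamma> m) + (\<Sum>j. b j * (ennreal (real (Suc j)) * \<gamma> j))
      = (\<Sum>j. ennreal (r ^ j * u j) * \<gamma> j + b j * (ennreal (real (Suc j)) * \<gamma> j))"
    by (subst suminf_add) auto
  also have "\<dots> \<le> (\<Sum>j. ennreal (2 - r) * (ennreal (u j) * \<gamma> j))"
  proof (intro suminf_le)
    fix j
    have "ennreal (r ^ j * u j) * \<gamma> j + b j * (ennreal (real (Suc j)) * \<gamma> j)
        = (ennreal (r ^ j * u j) + b j * ennreal (real (Suc j))) * \<gamma> j"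
      by (simp add: distrib_right mult.assoc)
    also have "ennreal (r ^ j * u j) + b j * ennreal (real (Suc j)) = ennreal (r ^ j * u j + (1 - r) * r ^ j * u j * real (Suc j))"
      using r u0 unfolding b_def by (subst ennreal_plus) (auto simp: ennreal_mult simp del: of_nat_Suc)
    also have "r ^ j * u j + (1 - r) * r ^ j * u j * real (Suc j) = r ^ j * (1 + (1 - r) * real (Suc j)) * u j"
      by (simp add: algebra_simps)
    also have "ennreal (r ^ j * (1 + (1 - r) * real (Suc j)) * u j) \<le> ennreal ((2 - r) * u j)"
      using u0 by (intro ennreal_leI mult_right_mono dilation_weight_le r)
    also have "\<dots> = ennreal (2 - r) * ennreal (u j)" using u0 r by (simp add: ennreal_mult)
    finally show "ennreal (r ^ j * u j) * \<gamma> j + b j * (ennreal (real (Suc j)) * \<gamma> j) \<le> ennreal (2 - r) * (ennreal (u j) * \<gamma> j)"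
      by (simp add: mult.assoc mult_right_mono)
  qed auto
  finally show ?thesis unfolding \<gamma>_def u_def by simp
qed

subsection \<open>Local energies\<close>

text \<open>The contribution of a single boundary point to \<open>D_mu_n\<close> with n =
  \<open>Suc N\<close> and g the n-th derivative, without the factorial constant. The exponent is
  \<open>Suc N\<close> because the numerator of the Poisson kernel joins the weight of exponent
  \<open>N\<close>.\<close>

definition local_energy :: "nat \<Rightarrow> (complex \<Rightarrow> complex) \<Rightarrow> complex \<Rightarrow> ennreal" where
  "local_energy N g \<zeta> = (\<integral>\<^sup>+z. ennreal ((cmod (g z) / cmod (z - \<zeta>))\<^sup>2 * (1 - (cmod z)\<^sup>2) ^ Suc N) \<partial>disc_area)"

text \<open>Since \<open>g\<close> is controlled only on the disc, it is replaced by its extension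
  by zero, which is Borel on the plane; measurability of an integral in its parameter then applies.
  It allows constants to leave the integral over \<mu>.\<close>

lemma borel_measurable_local_energy:
  assumes g: "continuous_on (ball 0 1) g"
  shows "local_energy N g \<in> borel_measurable borel"
proof -
  interpret D: finite_measure disc_area by (rule finite_measure_disc_area)
  define G where "G = (\<lambda>z. indicator (ball 0 1) z *\<^sub>R g z)"
  have [measurable]: "G \<in> borel_measurable borel"
    unfolding G_def by (rule borel_measurable_continuous_on_indicator) (use g in auto)
  have "local_energy N g \<zeta> = local_energy N G \<zeta>" for \<zeta>
    unfolding local_energy_def by (rule nn_integral_disc_area_cong) (simp add: G_def)
  moreover have "local_energy N G \<in> borel_measurable borel"
    unfolding local_energy_def by measurable
  ultimately show ?thesis by presburger
qed

lemma local_energy_cmult: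
  assumes g: "continuous_on (ball 0 1) g"
  shows "local_energy N (\<lambda>z. c * g z) \<zeta> = ennreal ((cmod c)\<^sup>2) * local_energy N g \<zeta>"
proof -
  define G where "G = (\<lambda>z. indicator (ball 0 1) z *\<^sub>R g z)"
  have [measurable]: "G \<in> borel_measurable borel"
    unfolding G_def by (rule borel_measurable_continuous_on_indicator) (use g in auto)
  have "local_energy N (\<lambda>z. c * g z) \<zeta>
      = (\<integral>\<^sup>+z. ennreal ((cmod c)\<^sup>2) * ennreal ((cmod (G z) / cmod (z - \<zeta>))\<^sup>2 * (1 - (cmod z)\<^sup>2) ^ Suc N) \<partial>disc_area)"
    unfolding local_energy_def
    by (rule nn_integral_disc_area_cong)
       (simp add: G_def norm_mult power_mult_distrib power_divide ennreal_mult'[symmetric] mult_ac)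
  also have "\<dots> = ennreal ((cmod c)\<^sup>2) * local_energy N G \<zeta>"
    unfolding local_energy_def by (rule nn_integral_cmult) measurable
  also have "local_energy N G \<zeta> = local_energy N g \<zeta>"
    unfolding local_energy_def by (rule nn_integral_disc_area_cong) (simp add: G_def)
  finally show ?thesis .
qed

text \<open>For a point \<zeta> of the circle, |z - \<zeta>| = |1 - \<omega> z| with \<omega> the
  conjugate of \<zeta>. Both energies thus become weighted Bergman norms of holomorphic functions
  and can be compared through their Taylor coefficients.\<close>

lemma local_energy_dilation_le:
  assumes g: "g holomorphic_on ball 0 1" and \<zeta>: "cmod \<zeta> = 1" and r: "0 \<le> r" "r < 1"
  shows "local_energy N (\<lambda>z. g (of_real r * z)) \<zeta>
    \<le> ennreal (2 - r) * local_energy N g \<zeta>"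
proof -
  define \<omega> where "\<omega> = cnj \<zeta>"
  have \<omega>: "cmod \<omega> = 1" using \<zeta> by (simp add: \<omega>_def)
  have dist: "cmod (z - \<zeta>) = cmod (1 - \<omega> * z)" for z
  proof -
    have "1 = \<omega> * \<zeta>" using \<zeta> complex_norm_square[of \<zeta>] by (simp add: \<omega>_def mult.commute)
    then have "cmod (1 - \<omega> * z) = cmod (\<omega> * (\<zeta> - z))" by (simp add: algebra_simps)
    then show ?thesis using \<omega> by (simp add: norm_mult norm_minus_commute)
  qed
  define h where "h = (\<lambda>z. g z / (1 - \<omega> * z))"
  define a where "a = (\<lambda>m. (deriv ^^ m) h 0 / fact m)"
  \<comment> \<open>The denominator has no zero in the open disc, so the Taylor series of
    \<open>h\<close> at 0 converges on all of it.\<close>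
  have "1 - \<omega> * z \<noteq> 0" if "cmod z < 1" for z
    using that \<omega> norm_mult[of \<omega> z] by (auto simp: right_minus_eq dest: arg_cong[of _ _ cmod])
  then have "h holomorphic_on ball 0 1"
    unfolding h_def by (intro holomorphic_intros g) auto
  then have sums: "(\<lambda>m. a m * z ^ m) sums (g z / (1 - \<omega> * z))" if "cmod z < 1" for z
    using holomorphic_power_series[of h 0 1 z] that by (simp add: a_def h_def)
  have sums': "(\<lambda>m. dilation_coeff \<omega> r a m * z ^ m) sums (g (of_real r * z) / (1 - \<omega> * z))" if "cmod z < 1" for z
    by (rule sums_dilation_coeff[OF sums \<omega> r that])
  show ?thesis
    using bergman_norm[of a "\<lambda>z. g z / (1 - \<omega> * z)" "Suc N", OF sums]
      bergman_norm[of "dilation_coeff \<omega> r a" "\<lambda>z. g (of_real r * z) / (1 - \<omega> * z)" "Suc N", OF sums']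
      bergman_dilation_le[OF \<omega> r, of a N]
    unfolding local_energy_def dist norm_divide by simp
qed

text \<open>Tonelli for the jointly measurable nonnegative kernel \<open>K\<close>, in which the
  Poisson kernel and the weight are merged. The extension by zero again supplies measurability in
  z.\<close>

lemma poisson_energy_Fubini:
  assumes \<mu>: "sets \<mu> = sets borel" "finite_measure \<mu>" and g: "continuous_on (ball 0 1) g"
  shows "(\<integral>\<^sup>+z. ennreal ((cmod (g z))\<^sup>2) * poisson_int \<mu> z * ennreal ((1 - (cmod z)\<^sup>2) ^ N) \<partial>dA)
    = (\<integral>\<^sup>+\<zeta>. local_energy N g \<zeta> \<partial>\<mu>)"
proof -
  note \<mu>(1)[measurable_cong]
  interpret \<mu>: finite_measure \<mu> by fact
  interpret D: finite_measure disc_area by (rule finite_measure_disc_area)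
  interpret pair_sigma_finite disc_area \<mu> ..
  define G where "G = (\<lambda>z. indicator (ball 0 1) z *\<^sub>R g z)"
  have [measurable]: "G \<in> borel_measurable borel"
    unfolding G_def by (rule borel_measurable_continuous_on_indicator) (use g in auto)
  have G: "G z = g z" if "cmod z < 1" for z using that by (simp add: G_def)
  define K where "K = (\<lambda>z \<zeta>. ennreal ((cmod (G z) / cmod (z - \<zeta>))\<^sup>2 * (1 - (cmod z)\<^sup>2) ^ Suc N))"
  have K[measurable]: "case_prod K \<in> borel_measurable (disc_area \<Otimes>\<^sub>M \<mu>)"
    unfolding K_def by measurable
  have "(\<integral>\<^sup>+z. ennreal ((cmod (g z))\<^sup>2) * poisson_int \<mu> z * ennreal ((1 - (cmod z)\<^sup>2) ^ N) \<partial>dA)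
      = (\<integral>\<^sup>+z. \<integral>\<^sup>+\<zeta>. K z \<zeta> \<partial>\<mu> \<partial>disc_area)"
  proof (rule nn_integral_dA)
    show "(\<lambda>z. \<integral>\<^sup>+\<zeta>. K z \<zeta> \<partial>\<mu>) \<in> borel_measurable borel"
      using \<mu>.borel_measurable_nn_integral[OF K] by simp
    fix z :: complex assume z: "cmod z < 1"
    then have *: "0 \<le> 1 - (cmod z)\<^sup>2" by (simp add: power_le_one)
    have "ennreal ((cmod (g z))\<^sup>2) * poisson_int \<mu> z * ennreal ((1 - (cmod z)\<^sup>2) ^ N)
        = (\<integral>\<^sup>+\<zeta>. ennreal ((cmod (g z))\<^sup>2) * ennreal ((1 - (cmod z)\<^sup>2) / (cmod (z - \<zeta>))\<^sup>2) * ennreal ((1 - (cmod z)\<^sup>2) ^ N) \<partial>\<mu>)"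
      unfolding poisson_int_def by (simp add: nn_integral_cmult nn_integral_multc)
    \<comment> \<open>The identity is pointwise in \<zeta>; where z = \<zeta>, both quotients are 0
      by the convention for division.\<close>
    also have "\<dots> = (\<integral>\<^sup>+\<zeta>. K z \<zeta> \<partial>\<mu>)"
      by (intro nn_integral_cong)
         (use * in \<open>simp add: K_def G[OF z] ennreal_mult'[symmetric] power_divide mult_ac\<close>)
    finally show "ennreal ((cmod (g z))\<^sup>2) * poisson_int \<mu> z * ennreal ((1 - (cmod z)\<^sup>2) ^ N) = \<dots>" .
  qed
  also have "\<dots> = (\<integral>\<^sup>+\<zeta>. \<integral>\<^sup>+z. K z \<zeta> \<partial>disc_area \<partial>\<mu>)"
    by (rule Fubini'[symmetric, OF K])
  also have "\<dots> = (\<integral>\<^sup>+\<zeta>. local_energy N g \<zeta> \<partial>\<mu>)"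
    unfolding local_energy_def by (intro nn_integral_cong nn_integral_disc_area_cong) (simp add: K_def G)
  finally show ?thesis .
qed

section \<open>Integration over the boundary measure and the final constant\<close>

theorem theorem2p6:
  fixes \<mu> :: "complex measure" and n :: nat and f :: "complex \<Rightarrow> complex" and r :: real
  assumes "n \<ge> 1"
    and "sets \<mu> = sets borel"
    and "finite_measure \<mu>"
    and "emeasure \<mu> (- sphere 0 1) = 0"
    and "f holomorphic_on ball 0 1"
    and "0 \<le> r" and "r < 1"
  shows "D_mu_n \<mu> n (\<lambda>z. f (complex_of_real r * z))
         \<le> ennreal (4 ^ (n - 1) * (2 - r) * r ^ (2 * n) / (1 + r) ^ (2 * n - 2)) * D_mu_n \<mu> n f"
proof -
  note r = \<open>0 \<le> r\<close> \<open>r < 1\<close>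
  note \<mu> = \<open>sets \<mu> = sets borel\<close> \<open>finite_measure \<mu>\<close>
  obtain N where n: "n = Suc N" using \<open>n \<ge> 1\<close> by (cases n) auto
  have n1: "n - 1 = N" by (simp add: n)
  define g where "g = (deriv ^^ n) f"
  have g: "g holomorphic_on ball 0 1"
    unfolding g_def by (intro holomorphic_higher_deriv \<open>f holomorphic_on ball 0 1\<close>) auto
  have maps: "of_real r * z \<in> ball 0 1" if "z \<in> ball 0 1" for z :: complex
    using that r mult_strict_mono'[of r 1 "cmod z" 1] by (simp add: norm_mult)
  \<comment> \<open>The chain rule contributes r^n, which becomes r^(2n) after squaring the
    modulus.\<close>
  have deriv: "(deriv ^^ n) (\<lambda>z. f (of_real r * z)) z = of_real (r ^ n) * g (of_real r * z)" if "cmod z < 1" for z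
    unfolding g_def of_real_power
    by (rule higher_deriv_compose_linear[OF \<open>f holomorphic_on ball 0 1\<close>, of "ball 0 1"]) (use that maps in auto)
  have gr: "continuous_on (ball 0 1) (\<lambda>z. g (of_real r * z))"
    by (intro continuous_intros continuous_on_compose2[OF holomorphic_on_imp_continuous_on[OF g]]) (use maps in auto)
  \<comment> \<open>The local estimate holds at points of the circle, and \<mu> has no mass
    elsewhere, so it holds almost everywhere.\<close>
  have "AE \<zeta> in \<mu>. \<zeta> \<notin> - sphere 0 1"
    by (rule AE_not_in) (use assms in \<open>auto simp: null_sets_def\<close>)
  then have AE: "AE \<zeta> in \<mu>. local_energy N (\<lambda>z. of_real (r ^ n) * g (of_real r * z)) \<zeta> \<le> ennreal (r ^ (2 * n) * (2 - r)) * local_energy N g \<zeta>"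
  proof eventually_elim
    case (elim \<zeta>)
    have "local_energy N (\<lambda>z. of_real (r ^ n) * g (of_real r * z)) \<zeta>
       = ennreal (r ^ (2 * n)) * local_energy N (\<lambda>z. g (of_real r * z)) \<zeta>"
      using r by (subst local_energy_cmult[OF gr]) (simp add: norm_power power_even_eq)
    also have "\<dots> \<le> ennreal (r ^ (2 * n)) * (ennreal (2 - r) * local_energy N g \<zeta>)"
      by (intro mult_left_mono local_energy_dilation_le g r) (use elim in auto)
    also have "\<dots> = ennreal (r ^ (2 * n) * (2 - r)) * local_energy N g \<zeta>"
      using r by (simp add: ennreal_mult mult.assoc)
    finally show ?case .
  qed
  \<comment> \<open>From (1 + r)^2 \<le> 4, the factor 4^N / (1 + r)^(2N) is at least 1. The bound
    r^(2n) (2 - r) obtained from the local estimates is therefore at most the stated constant, with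
    N = n - 1.\<close>
  have "(1 + r) ^ (2 * N) \<le> 4 ^ N"
    using r power_mono[of "(1 + r)\<^sup>2" 4 N] power_mono[of "1 + r" 2 2] by (simp add: power_mult)
  then have "r ^ (2 * n) * (2 - r) * 1 \<le> r ^ (2 * n) * (2 - r) * (4 ^ N / (1 + r) ^ (2 * N))"
    using r by (intro mult_left_mono) auto
  then have const: "r ^ (2 * n) * (2 - r) \<le> 4 ^ (n - 1) * (2 - r) * r ^ (2 * n) / (1 + r) ^ (2 * n - 2)"
    by (simp add: n mult_ac)
  have "(\<integral>\<^sup>+z. ennreal ((cmod ((deriv ^^ n) (\<lambda>z. f (of_real r * z)) z))\<^sup>2) * poisson_int \<mu> z * ennreal ((1 - (cmod z)\<^sup>2) ^ N) \<partial>dA)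
     = (\<integral>\<^sup>+z. ennreal ((cmod (of_real (r ^ n) * g (of_real r * z)))\<^sup>2) * poisson_int \<mu> z * ennreal ((1 - (cmod z)\<^sup>2) ^ N) \<partial>dA)"
    \<comment> \<open>The space of \<open>dA\<close> is the open disc, where the chain rule formula
      is available.\<close>
    by (rule nn_integral_cong) (simp add: dA_def space_restrict_space deriv)
  also have "\<dots> = (\<integral>\<^sup>+\<zeta>. local_energy N (\<lambda>z. of_real (r ^ n) * g (of_real r * z)) \<zeta> \<partial>\<mu>)"
    by (rule poisson_energy_Fubini[OF \<mu> continuous_on_mult_left[OF gr]])
  also have "\<dots> \<le> (\<integral>\<^sup>+\<zeta>. ennreal (r ^ (2 * n) * (2 - r)) * local_energy N g \<zeta> \<partial>\<mu>)"
    by (rule nn_integral_mono_AE[OF AE])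
  also have "\<dots> = ennreal (r ^ (2 * n) * (2 - r)) * (\<integral>\<^sup>+\<zeta>. local_energy N g \<zeta> \<partial>\<mu>)"
    using borel_measurable_local_energy[OF holomorphic_on_imp_continuous_on[OF g]]
    by (intro nn_integral_cmult) (simp add: measurable_cong_sets[OF \<mu>(1) refl])
  also have "(\<integral>\<^sup>+\<zeta>. local_energy N g \<zeta> \<partial>\<mu>) = (\<integral>\<^sup>+z. ennreal ((cmod (g z))\<^sup>2) * poisson_int \<mu> z * ennreal ((1 - (cmod z)\<^sup>2) ^ N) \<partial>dA)"
    by (rule poisson_energy_Fubini[OF \<mu> holomorphic_on_imp_continuous_on[OF g], symmetric])
  finally have "(\<integral>\<^sup>+z. ennreal ((cmod ((deriv ^^ n) (\<lambda>z. f (of_real r * z)) z))\<^sup>2) * poisson_int \<mu> z * ennreal ((1 - (cmod z)\<^sup>2) ^ N) \<partial>dA)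
     \<le> ennreal (4 ^ (n - 1) * (2 - r) * r ^ (2 * n) / (1 + r) ^ (2 * n - 2)) *
       (\<integral>\<^sup>+z. ennreal ((cmod (g z))\<^sup>2) * poisson_int \<mu> z * ennreal ((1 - (cmod z)\<^sup>2) ^ N) \<partial>dA)"
    by (rule order_trans[OF _ mult_right_mono[OF ennreal_leI[OF const]]]) simp
  then have "ennreal (1 / (fact n * fact (n - 1))) * (\<integral>\<^sup>+z. ennreal ((cmod ((deriv ^^ n) (\<lambda>z. f (of_real r * z)) z))\<^sup>2) * poisson_int \<mu> z * ennreal ((1 - (cmod z)\<^sup>2) ^ N) \<partial>dA)
     \<le> ennreal (1 / (fact n * fact (n - 1))) * (ennreal (4 ^ (n - 1) * (2 - r) * r ^ (2 * n) / (1 + r) ^ (2 * n - 2)) *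
       (\<integral>\<^sup>+z. ennreal ((cmod (g z))\<^sup>2) * poisson_int \<mu> z * ennreal ((1 - (cmod z)\<^sup>2) ^ N) \<partial>dA))"
    by (rule mult_left_mono) simp
  then show ?thesis
    unfolding D_mu_n_def g_def n1 by (simp only: n1 mult.left_commute)
qed

end
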